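(* Let $n\ge 1$, and let $a_0,a_1,\dots,a_n,x_1,x_2,\dots$ be indeterminates. Let $p=p_n$, $q=q_n$ be the numerator and denominator of the $n$-th convergent of $[a_0,a_1,\dots,a_n]$, and let $\varepsilon=(-1)^n$ in the definition of the modified continuants $K'$. Let $W$ denote the word $a_1,a_2,\dots,a_n$ and $\overline{W}$ the word $-a_n,-a_{n-1},\dots,-a_1$. For $k\ge 2$ let $$S_k=[a_0,W_1,x_1,W_2,x_2,W_3,\dots,x_{k-1},W_k],$$ where $W_i=W$ for $i$ odd and $W_i=\overline{W}$ for $i$ even (so $S_2=[a_0,a_1,\dots,a_n,x_1,-a_n,\dots,-a_1]$, $S_3=[a_0,a_1,\dots,a_n,x_1,-a_n,\dots,-a_1,x_2,a_1,\dots,a_n]$, etc.). Then for all $k\ge 2$, $$S_k=\frac{p}{q}+\frac{(-1)^n\,K'(x_2q,x_3q,\dots,x_{k-1}q)}{q\,K'(x_1q,x_2q,\dots,x_{k-1}q)}$$ as an identity of rational functions (for $k=2$ the numerator continuant has no variables and equals $1$).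
   Context: $[b_0,b_1,\dots,b_m]$ denotes the finite continued fraction $b_0+\cfrac{1}{b_1+\cfrac{1}{\ddots+\cfrac{1}{b_m}}}$. Convergents of $[a_0,\dots,a_n]$: $p_0=a_0$, $q_0=1$, $p_1=a_0a_1+1$, $q_1=a_1$, and $p_j=a_jp_{j-1}+p_{j-2}$, $q_j=a_jq_{j-1}+q_{j-2}$ for $j\ge2$. Modified continuants for fixed $\varepsilon=\pm1$: $K'(\,)=1$, $K'(y_1)=y_1$, $K'(y_1,y_2)=y_1y_2+\varepsilon$, and $K'(y_1,\dots,y_k)=K'(y_1,\dots,y_{k-1})y_k+\varepsilon K'(y_1,\dots,y_{k-2})$ for $k\ge2$. *)

theory Defs
  imports "HOL-Library.Poly_Mapping" "HOL-Computational_Algebra.Fraction_Field"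
begin

section \<open>The field of rational functions in the indeterminates $a_i$ and $x_i$\<close>

datatype indet = Ind_a nat | Ind_x nat

text \<open>
  The linear order on the indeterminates has no mathematical significance; the library
  asks for one to show that the polynomial ring below is an integral domain.
\<close>

fun indet_rank :: "indet \<Rightarrow> nat" where
  "indet_rank (Ind_a i) = 2 * i"
| "indet_rank (Ind_x i) = 2 * i + 1"

lemma indet_rank_inject: "indet_rank u = indet_rank v \<Longrightarrow> u = v"
  by (cases u; cases v) (simp_all, presburger+)

instantiation indet :: linorder
begin

definition less_eq_indet :: "indet \<Rightarrow> indet \<Rightarrow> bool" where
  "u \<le> v \<longleftrightarrow> indet_rank u \<le> indet_rank v"

definition less_indet :: "indet \<Rightarrow> indet \<Rightarrow> bool" where
  "u < v \<longleftrightarrow> indet_rank u < indet_rank v"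

instance
  by standard (auto simp: less_eq_indet_def less_indet_def intro: indet_rank_inject)

end

text \<open>
  A monomial is a finitely supported exponent function, a polynomial a finitely supported
  coefficient function on monomials (with convolution product).
\<close>

type_synonym 'k ratfun = "((indet \<Rightarrow>\<^sub>0 nat) \<Rightarrow>\<^sub>0 'k) fract"

definition indet_fun :: "indet \<Rightarrow> 'k :: field ratfun" where
  "indet_fun v = Fract (Poly_Mapping.single (Poly_Mapping.single v 1) 1) 1"

definition ind_a :: "nat \<Rightarrow> 'k :: field ratfun" where
  "ind_a i = indet_fun (Ind_a i)"

definition ind_x :: "nat \<Rightarrow> 'k :: field ratfun" where
  "ind_x i = indet_fun (Ind_x i)"


section \<open>Continued fractions, convergents and modified continuants\<close>

text \<open>The value at the empty list is a dummy.\<close>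

fun cfrac :: "'a :: field list \<Rightarrow> 'a" where
  "cfrac [] = 0"
| "cfrac [b] = b"
| "cfrac (b # c # bs) = b + 1 / cfrac (c # bs)"

text \<open>
  Since division is total in HOL, we state separately that no division by zero occurs in the
  evaluation of a continued fraction.
\<close>

fun cfrac_defined :: "'a :: field list \<Rightarrow> bool" where
  "cfrac_defined [] \<longleftrightarrow> False"
| "cfrac_defined [b] \<longleftrightarrow> True"
| "cfrac_defined (b # c # bs) \<longleftrightarrow> cfrac_defined (c # bs) \<and> cfrac (c # bs) \<noteq> 0"

fun conv_num :: "(nat \<Rightarrow> 'a :: comm_ring_1) \<Rightarrow> nat \<Rightarrow> 'a" where
  "conv_num b 0 = b 0"
| "conv_num b (Suc 0) = b 0 * b 1 + 1"
| "conv_num b (Suc (Suc j)) = b (Suc (Suc j)) * conv_num b (Suc j) + conv_num b j"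

fun conv_den :: "(nat \<Rightarrow> 'a :: comm_ring_1) \<Rightarrow> nat \<Rightarrow> 'a" where
  "conv_den b 0 = 1"
| "conv_den b (Suc 0) = b 1"
| "conv_den b (Suc (Suc j)) = b (Suc (Suc j)) * conv_den b (Suc j) + conv_den b j"

text \<open>
  In the third equation the argument list is $y_1, \ldots, y_k$ with $k \geq 2$, and the
  recursion removes entries from its right end.
\<close>

fun mod_continuant :: "'a :: comm_ring_1 \<Rightarrow> 'a list \<Rightarrow> 'a" where
  "mod_continuant \<epsilon> [] = 1"
| "mod_continuant \<epsilon> [y] = y"
| "mod_continuant \<epsilon> (y # z # ys) =
     mod_continuant \<epsilon> (butlast (y # z # ys)) * last (y # z # ys) +
     \<epsilon> * mod_continuant \<epsilon> (butlast (butlast (y # z # ys)))"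


section \<open>The folded continued fraction\<close>

definition word :: "nat \<Rightarrow> 'k :: field ratfun list" where
  "word n = map ind_a [1..<Suc n]"

definition word_bar :: "nat \<Rightarrow> 'k :: field ratfun list" where
  "word_bar n = map uminus (rev (word n))"

definition folded_word :: "nat \<Rightarrow> nat \<Rightarrow> 'k :: field ratfun list" where
  "folded_word n i = (if odd i then word n else word_bar n)"

definition S_entries :: "nat \<Rightarrow> nat \<Rightarrow> 'k :: field ratfun list" where
  "S_entries n k =
     ind_a 0 # folded_word n 1 @ concat (map (\<lambda>i. ind_x i # folded_word n (Suc i)) [1..<k])"

definition S_cfrac :: "nat \<Rightarrow> nat \<Rightarrow> 'k :: field ratfun" where
  "S_cfrac n k = cfrac (S_entries n k)"

end

theory Submission
  imports Defs
begin

text \<open>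
  Write the word \<open>W\<close> as a Moebius transformation with matrix rows \<open>(q, q')\<close>, \<open>(r, r')\<close> and
  determinant \<open>\<epsilon>\<close>. The reversed negated word then has the matrix with rows
  \<open>\<epsilon> (q, -r)\<close>, \<open>\<epsilon> (-q', r')\<close>. If \<open>R\<^sub>i\<close> is the tail of the continued fraction
  starting at \<open>x\<^sub>i\<close>, put \<open>z\<^sub>i = q R\<^sub>i + q'\<close> for odd \<open>i\<close> and \<open>z\<^sub>i = q R\<^sub>i - r\<close> for even
  \<open>i\<close>. A computation gives \<open>z\<^sub>i = x\<^sub>i q + \<epsilon> / z\<^sub>i\<^sub>+\<^sub>1\<close>, which is also the recursion of the
  quotients of modified continuants, and \<open>S\<^sub>k = p / q + \<epsilon> / (q z\<^sub>1)\<close>.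

  No division by zero occurs: the value of a continued fraction whose entries are nonzero
  multiples of indeterminates has a numerator with larger leading monomial than its
  denominator.
\<close>

section \<open>Modified continuants: recursion at both ends\<close>

lemma mod_continuant_append2:
  "mod_continuant e (ys @ [y, z]) = mod_continuant e (ys @ [y]) * z + e * mod_continuant e ys"
  \<comment> \<open>The rule serves only as a case split into empty, singleton and longer
    lists.\<close>
  by (cases ys rule: remdups_adj.cases) (auto simp: butlast_append)

text \<open>The folding recursion peels entries off the left. Expanding each term at its right end
  reduces the claim to \<open>ys\<close> shortened by one and by two entries, hence the induction on
  length.\<close>

lemma mod_continuant_Cons2:
  "mod_continuant e (y # z # ys) = y * mod_continuant e (z # ys) + e * mod_continuant e ys"
proof (induction ys rule: length_induct)
  case (1 ys)
  show ?case
  proof (cases ys rule: rev_cases)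
    case Nil
    then show ?thesis by simp
  next
    case (snoc ys' w)
    note ys = snoc
    show ?thesis
    proof (cases ys' rule: rev_cases)
      case Nil
      then show ?thesis using ys by (simp add: algebra_simps)
    next
      case (snoc us v)
      have ys: "ys = us @ [v, w]"
        using ys snoc by simp
      have IH: "mod_continuant e (y # z # zs) = y * mod_continuant e (z # zs) + e * mod_continuant e zs"
        if "length zs < length ys" for zs
        using 1 that by blast
      have "mod_continuant e (y # z # us @ [v, w]) =
          mod_continuant e (y # z # us @ [v]) * w + e * mod_continuant e (y # z # us)"
        and "mod_continuant e (z # us @ [v, w]) =
          mod_continuant e (z # us @ [v]) * w + e * mod_continuant e (z # us)"
        using mod_continuant_append2[of e "y # z # us" v w] mod_continuant_append2[of e "z # us" v w]
        by (simp_all del: mod_continuant.simps(3))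
      then show ?thesis
        using IH[of us] IH[of "us @ [v]"]
        by (simp add: ys mod_continuant_append2 algebra_simps del: mod_continuant.simps(3))
    qed
  qed
qed

section \<open>Continued fractions as Moebius transformations\<close>

text \<open>
  The tuple \<open>(A, B, C, D)\<close> stands for the matrix with rows \<open>(A, B)\<close>, \<open>(C, D)\<close>, the product of
  the matrices with rows \<open>(b, 1)\<close>, \<open>(1, 0)\<close> over the entries \<open>b\<close> of the list.
\<close>

fun cfrac_matrix :: "'a :: comm_ring_1 list \<Rightarrow> 'a \<times> 'a \<times> 'a \<times> 'a" where
  "cfrac_matrix [] = (1, 0, 0, 1)"
| "cfrac_matrix (b # bs) =
     (case cfrac_matrix bs of (A, B, C, D) \<Rightarrow> (b * A + C, b * B + D, A, B))"

lemma cfrac_matrix_snoc: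
  "cfrac_matrix (bs @ [b]) =
     (case cfrac_matrix bs of (A, B, C, D) \<Rightarrow> (A * b + B, A, C * b + D, C))"
  by (induction bs) (auto simp: algebra_simps split: prod.splits)

lemma cfrac_matrix_det:
  "cfrac_matrix bs = (A, B, C, D) \<Longrightarrow> A * D - B * C = (-1) ^ length bs"
proof (induction bs arbitrary: A B C D)
  case (Cons b bs)
  obtain A' B' C' D' where M: "cfrac_matrix bs = (A', B', C', D')"
    by (rule prod_cases4)
  have "(b * A' + C') * B' - (b * B' + D') * A' = - (A' * D' - B' * C')"
    by (simp add: algebra_simps)
  then show ?case using Cons.IH[OF M] Cons.prems M by auto
qed simp

text \<open>Reversal transposes the product, since each factor is symmetric. Negating an entry turns
  its factor \<open>M\<close> into \<open>- J M J\<close> with \<open>J = diag(1, -1)\<close>; the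
  inner \<open>J\<close> cancel and the signs multiply to \<open>e\<close>.\<close>

lemma cfrac_matrix_bar:
  "cfrac_matrix bs = (A, B, C, D) \<Longrightarrow> e = (-1) ^ length bs \<Longrightarrow>
     cfrac_matrix (map uminus (rev bs)) = (e * A, - e * C, - e * B, e * D)"
proof (induction bs arbitrary: A B C D e)
  case (Cons b bs)
  obtain A' B' C' D' where M: "cfrac_matrix bs = (A', B', C', D')"
    by (rule prod_cases4)
  have "A = b * A' + C'" "B = b * B' + D'" "C = A'" "D = B'" "e = - ((-1) ^ length bs)"
    using Cons.prems M by auto
  with Cons.IH[OF M refl] show ?case
    by (simp add: cfrac_matrix_snoc algebra_simps)
qed simp

lemma cfrac_matrix_convergents:
  "cfrac_matrix (map b [0..<Suc (Suc n)]) =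
     (conv_num b (Suc n), conv_num b n, conv_den b (Suc n), conv_den b n)"
proof (induction n)
  case 0
  then show ?case by (simp add: upt_rec)
next
  case (Suc n)
  have "map b [0..<Suc (Suc (Suc n))] = map b [0..<Suc (Suc n)] @ [b (Suc (Suc n))]"
    by simp
  then show ?case
    by (simp only: cfrac_matrix_snoc Suc.IH) (simp add: mult.commute)
qed

lemma cfrac_Cons: "bs \<noteq> [] \<Longrightarrow> cfrac (b # bs) = b + 1 / cfrac bs"
  by (cases bs) auto

lemma cfrac_defined_Cons:
  "bs \<noteq> [] \<Longrightarrow> cfrac_defined (b # bs) \<longleftrightarrow> cfrac_defined bs \<and> cfrac bs \<noteq> 0"
  by (cases bs) auto

text \<open>The denominator for \<open>b # bs\<close> is the numerator for \<open>bs\<close>, and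
  definedness makes that numerator nonzero; so nonvanishing is carried through the
  induction.\<close>

lemma cfrac_append:
  assumes "cfrac_defined (bs @ cs)" "cs \<noteq> []" "cfrac_matrix bs = (A, B, C, D)"
  shows "C * cfrac cs + D \<noteq> 0 \<and> cfrac (bs @ cs) = (A * cfrac cs + B) / (C * cfrac cs + D)"
  using assms
proof (induction bs arbitrary: A B C D)
  case (Cons b bs)
  obtain A' B' C' D' where M: "cfrac_matrix bs = (A', B', C', D')"
    by (rule prod_cases4)
  define N where "N = A' * cfrac cs + B'"
  have "cfrac_defined (bs @ cs)" "cfrac (bs @ cs) \<noteq> 0"
    using Cons.prems by (auto simp: cfrac_defined_Cons)
  with Cons.IH[OF _ _ M] Cons.prems(2) have "N \<noteq> 0" and
    val: "cfrac (bs @ cs) = N / (C' * cfrac cs + D')"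
    by (auto simp: N_def)
  have ABCD: "A = b * A' + C'" "B = b * B' + D'" "C = A'" "D = B'"
    using Cons.prems(3) M by auto
  have "A * cfrac cs + B = b * N + (C' * cfrac cs + D')"
    by (simp add: ABCD N_def algebra_simps)
  moreover have "cfrac ((b # bs) @ cs) = b + (C' * cfrac cs + D') / N"
    using Cons.prems(2) val by (simp add: cfrac_Cons)
  moreover have "C * cfrac cs + D = N"
    by (simp add: ABCD N_def)
  ultimately show ?case using \<open>N \<noteq> 0\<close> by (simp add: add_divide_distrib)
qed auto

text \<open>This corresponds to an infinite tail in \<open>cfrac_append\<close>; the last entry is
  split off to serve as a nonempty tail.\<close>

lemma cfrac_eq_matrix:
  assumes "cfrac_defined bs" "cfrac_matrix bs = (A, B, C, D)"
  shows "C \<noteq> 0 \<and> cfrac bs = A / C"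
proof -
  from assms(1) have "bs \<noteq> []" by auto
  then obtain as b where bs: "bs = as @ [b]" by (cases bs rule: rev_cases) auto
  obtain A' B' C' D' where "cfrac_matrix as = (A', B', C', D')"
    by (rule prod_cases4)
  then show ?thesis
    using cfrac_append[of as "[b]" A' B' C' D'] assms bs by (auto simp: cfrac_matrix_snoc)
qed

lemma cfrac_defined_appendD: "cfrac_defined (bs @ cs) \<Longrightarrow> cs \<noteq> [] \<Longrightarrow> cfrac_defined cs"
  by (induction bs) (auto simp: cfrac_defined_Cons)

section \<open>The folding recursion\<close>

text \<open>Swapping the words replaces the parity test of \<open>folded_word\<close>, so that
  induction over the \<open>x\<close> entries needs no index.\<close>

fun folded_tail :: "'a list \<Rightarrow> 'a list \<Rightarrow> 'a list \<Rightarrow> 'a list" where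
  "folded_tail U V [] = []"
| "folded_tail U V (x # xs) = x # V @ folded_tail V U xs"

lemma folded_tail_eq_concat:
  "folded_tail (folded_word n i) (folded_word n (Suc i)) (map ind_x [i..<i + d]) =
     (concat (map (\<lambda>i. ind_x i # folded_word n (Suc i)) [i..<i + d]) :: 'k :: field ratfun list)"
proof (induction d arbitrary: i)
  case (Suc d)
  have "folded_word n (Suc (Suc i)) = (folded_word n i :: 'k ratfun list)"
    by (simp add: folded_word_def)
  moreover have "[i..<i + Suc d] = i # [Suc i..<Suc i + d]"
    by (simp add: upt_conv_Cons del: upt_Suc)
  ultimately show ?case using Suc.IH[of "Suc i"] by (simp del: upt_Suc)
qed simp

text \<open>
  Passing from \<open>xs\<close> to \<open>x # xs\<close> exchanges the roles of the two words, so the two equations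
  have to be proved together.
\<close>

lemma cfrac_folded_tail:
  fixes U V xs :: "'a :: field list"
  assumes U: "cfrac_matrix U = (A, B, C, D)"
    and V: "cfrac_matrix V = (e * A, - e * C, - e * B, e * D)"
    and det: "A * D - B * C = e" and e: "e * e = 1"
    and ne: "U \<noteq> []" "V \<noteq> []" "xs \<noteq> []"
  defines "K \<equiv> \<lambda>zs. mod_continuant e (map (\<lambda>x. x * A) zs)"
  shows "(cfrac_defined (folded_tail U V xs) \<longrightarrow>
            A * cfrac (folded_tail U V xs) + B = K xs / K (tl xs)) \<and>
         (cfrac_defined (folded_tail V U xs) \<longrightarrow>
            A * cfrac (folded_tail V U xs) - C = K xs / K (tl xs))"
  using ne(3)
proof (induction xs)
  case (Cons x xs)
  have e0: "e \<noteq> 0" using e by (metis mult_zero_left zero_neq_one)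
  show ?case
  proof (cases xs)
    case Nil
    \<comment> \<open>The matrix of \<open>V\<close> gives \<open>1 / cfrac V = - B / A\<close>,
      which cancels \<open>B\<close>.\<close>
    have "A * cfrac (x # V) + B = x * A" if d: "cfrac_defined (x # V)"
    proof -
      have "cfrac_defined V" "cfrac V \<noteq> 0" using d ne by (auto simp: cfrac_defined_Cons)
      with cfrac_eq_matrix[OF _ V] have "A \<noteq> 0" "1 / cfrac V = - (B / A)"
        using e0 by auto
      then show ?thesis using ne by (simp add: cfrac_Cons right_diff_distrib mult.commute)
    qed
    moreover have "A * cfrac (x # U) - C = x * A" if d: "cfrac_defined (x # U)"
    proof -
      have "cfrac_defined U" "cfrac U \<noteq> 0" using d ne by (auto simp: cfrac_defined_Cons)
      with cfrac_eq_matrix[OF _ U] have "A \<noteq> 0" "1 / cfrac U = C / A"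
        by auto
      then show ?thesis using ne by (simp add: cfrac_Cons distrib_left mult.commute)
    qed
    ultimately show ?thesis using Nil by (simp add: K_def)
  next
    case (Cons y ys)
    \<comment> \<open>Where \<open>K (tl xs)\<close> vanishes, both sides reduce to
      \<open>x * A\<close> by the convention on division by zero.\<close>
    have rec: "K (x # xs) / K xs = x * A + e / (K xs / K (tl xs))" if "K xs \<noteq> 0"
      using that
      by (simp add: K_def Cons mod_continuant_Cons2 add_divide_distrib del: mod_continuant.simps(3))
    have ne_tail: "folded_tail U V xs \<noteq> []" "folded_tail V U xs \<noteq> []"
      by (simp_all add: Cons)
    have "A * cfrac (folded_tail U V (x # xs)) + B = K (x # xs) / K xs"
      if d: "cfrac_defined (folded_tail U V (x # xs))"
    proof -
      define R where "R = cfrac (folded_tail V U xs)"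
      have d': "cfrac_defined (V @ folded_tail V U xs)" and
        nz: "cfrac (V @ folded_tail V U xs) \<noteq> 0"
        using d ne by (auto simp: cfrac_defined_Cons)
      have IH: "A * R - C = K xs / K (tl xs)"
        using Cons.IH Cons cfrac_defined_appendD[OF d' ne_tail(2)] by (auto simp: R_def)
      have "e * A * R + - e * C = e * (A * R - C)" "- e * B * R + e * D = e * (D - B * R)"
        by (simp_all add: algebra_simps)
      then have val: "cfrac (V @ folded_tail V U xs) = (A * R - C) / (D - B * R)"
        using cfrac_append[OF d' ne_tail(2) V] e0 by (simp add: R_def)
      then have AR: "A * R - C \<noteq> 0" using nz by auto
      \<comment> \<open>A zero \<open>K xs\<close> would make the quotient in \<open>IH\<close>
        zero.\<close>
      then have "K xs \<noteq> 0" using IH by auto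
      have "A * cfrac (folded_tail U V (x # xs)) + B = A * (x + (D - B * R) / (A * R - C)) + B"
        using ne val by (simp add: cfrac_Cons)
      also have "\<dots> = x * A + e / (A * R - C)"
      proof -
        \<comment> \<open>\<open>R\<close> cancels and only the determinant remains.\<close>
        have "A * (D - B * R) + B * (A * R - C) = e"
          by (simp add: algebra_simps flip: det)
        then have "A * (D - B * R) / (A * R - C) + B = e / (A * R - C)"
          using AR by (metis add_divide_distrib nonzero_mult_div_cancel_right)
        then show ?thesis by (simp add: distrib_left mult.commute add.assoc)
      qed
      finally show ?thesis using rec[OF \<open>K xs \<noteq> 0\<close>] IH by simp
    qed
    \<comment> \<open>The mirror case passes through the matrix of \<open>U\<close>, which carries
      no factor \<open>e\<close>.\<close>
    moreover have "A * cfrac (folded_tail V U (x # xs)) - C = K (x # xs) / K xs"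
      if d: "cfrac_defined (folded_tail V U (x # xs))"
    proof -
      define R where "R = cfrac (folded_tail U V xs)"
      have d': "cfrac_defined (U @ folded_tail U V xs)" and
        nz: "cfrac (U @ folded_tail U V xs) \<noteq> 0"
        using d ne by (auto simp: cfrac_defined_Cons)
      have IH: "A * R + B = K xs / K (tl xs)"
        using Cons.IH Cons cfrac_defined_appendD[OF d' ne_tail(1)] by (auto simp: R_def)
      have val: "cfrac (U @ folded_tail U V xs) = (A * R + B) / (C * R + D)"
        using cfrac_append[OF d' ne_tail(1) U] by (auto simp: R_def)
      then have AR: "A * R + B \<noteq> 0" using nz by auto
      then have "K xs \<noteq> 0" using IH by auto
      have "A * cfrac (folded_tail V U (x # xs)) - C = A * (x + (C * R + D) / (A * R + B)) - C"
        using ne val by (simp add: cfrac_Cons)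
      also have "\<dots> = x * A + e / (A * R + B)"
      proof -
        have "A * (C * R + D) - C * (A * R + B) = e"
          by (simp add: algebra_simps flip: det)
        then have "A * (C * R + D) / (A * R + B) - C = e / (A * R + B)"
          using AR by (metis diff_divide_distrib nonzero_mult_div_cancel_right)
        then show ?thesis by (simp add: distrib_left mult.commute add_diff_eq[symmetric])
      qed
      finally show ?thesis using rec[OF \<open>K xs \<noteq> 0\<close>] IH by simp
    qed
    ultimately show ?thesis by simp
  qed
qed simp

section \<open>No division by zero: leading monomials\<close>

lemma lookup_single_times:
  fixes f :: "'m :: cancel_comm_monoid_add \<Rightarrow>\<^sub>0 'a :: semiring_0"
  shows "Poly_Mapping.lookup (Poly_Mapping.single a c * f) (a + m) = c * Poly_Mapping.lookup f m"
proof -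
  have "Poly_Mapping.lookup (Poly_Mapping.single a c * f) (a + m) =
      (\<Sum>l. (c * (\<Sum>q. Poly_Mapping.lookup f q when a + m = l + q)) when a = l)"
    unfolding lookup_mult lookup_single when_mult ..
  then show ?thesis by simp
qed

text \<open>The order on exponent functions is lexicographic, decided at the smallest indeterminate
  where they differ.\<close>

lemma single_pos: "0 < Poly_Mapping.single (v :: 'v :: linorder) (1 :: nat)"
  by transfer (auto simp: less_fun_def when_def)

definition indet_multiple :: "'k :: field ratfun \<Rightarrow> bool" where
  "indet_multiple b \<longleftrightarrow>
     (\<exists>v c. c \<noteq> 0 \<and> b = Fract (Poly_Mapping.single (Poly_Mapping.single v 1) c) 1)"

lemma indet_multiple_ind_a: "indet_multiple (ind_a i)"
  and indet_multiple_ind_x: "indet_multiple (ind_x i)"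
  unfolding indet_multiple_def ind_a_def ind_x_def indet_fun_def by (metis one_neq_zero)+

lemma indet_multiple_uminus: "indet_multiple b \<Longrightarrow> indet_multiple (- b)"
  unfolding indet_multiple_def by (metis minus_fract single_uminus neg_equal_0_iff_equal)

text \<open>The monomial \<open>m\<close> forces \<open>f\<close> to be nonzero, so the next
  division is legitimate. The new value is \<open>(b * f + g) / f\<close>, and the top monomial of
  \<open>b * f\<close> is the new witness.\<close>

lemma cfrac_indet_multiples:
  fixes bs :: "'k :: field ratfun list"
  assumes "bs \<noteq> []" "\<And>b. b \<in> set bs \<Longrightarrow> indet_multiple b"
  shows "cfrac_defined bs \<and> (\<exists>f g m. cfrac bs = Fract f g \<and> g \<noteq> 0 \<and>
           m \<in> Poly_Mapping.keys f \<and> (\<forall>m' \<in> Poly_Mapping.keys g. m' < m))"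
  using assms
proof (induction bs rule: list_nonempty_induct)
  case (single b)
  then obtain v c where "c \<noteq> 0" and
    b: "b = Fract (Poly_Mapping.single (Poly_Mapping.single v 1) c) 1"
    by (auto simp: indet_multiple_def)
  then have "Poly_Mapping.single v 1 \<in>
      Poly_Mapping.keys (Poly_Mapping.single (Poly_Mapping.single v 1) c)"
    by simp
  moreover have "\<forall>m' \<in> Poly_Mapping.keys (1 :: (indet \<Rightarrow>\<^sub>0 nat) \<Rightarrow>\<^sub>0 'k). m' < Poly_Mapping.single v 1"
    using single_pos[of v] by simp
  ultimately show ?case using b by (metis cfrac.simps(2) cfrac_defined.simps(2) zero_neq_one)
next
  case (cons b bs)
  from cons.prems obtain v c where "c \<noteq> 0" and
    b: "b = Fract (Poly_Mapping.single (Poly_Mapping.single v 1) c) 1"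
    by (force simp: indet_multiple_def)
  obtain f g m where d: "cfrac_defined bs" and fg: "cfrac bs = Fract f g" "g \<noteq> 0"
    and m: "m \<in> Poly_Mapping.keys f" "\<And>m'. m' \<in> Poly_Mapping.keys g \<Longrightarrow> m' < m"
    using cons.IH cons.prems by auto
  have "f \<noteq> 0" using m(1) by auto
  then have nz: "cfrac bs \<noteq> 0" using fg by (simp add: Zero_fract_def eq_fract)
  define u :: "indet \<Rightarrow>\<^sub>0 nat" where "u = Poly_Mapping.single v 1"
  define M where "M = Max (Poly_Mapping.keys f)"
  have M: "M \<in> Poly_Mapping.keys f" "\<And>m'. m' \<in> Poly_Mapping.keys f \<Longrightarrow> m' \<le> M"
    using m(1) by (auto simp: M_def intro!: Max_in)
  have less: "M < u + M"
    using add_strict_right_mono[OF single_pos[of v], of M] by (simp add: u_def)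
  \<comment> \<open>All of \<open>g\<close> lies below \<open>m\<close>, hence below
    \<open>u + M\<close>, so the top term cannot cancel.\<close>
  have "u + M \<notin> Poly_Mapping.keys g"
    using m M less by (metis less_asym order.strict_trans1)
  then have "Poly_Mapping.lookup (Poly_Mapping.single u c * f + g) (u + M) = c * Poly_Mapping.lookup f M"
    by (simp add: lookup_add lookup_single_times in_keys_iff)
  then have "u + M \<in> Poly_Mapping.keys (Poly_Mapping.single u c * f + g)"
    using M(1) \<open>c \<noteq> 0\<close> by (simp add: in_keys_iff)
  moreover have "\<forall>m' \<in> Poly_Mapping.keys f. m' < u + M"
    using M(2) less by force
  moreover have "cfrac (b # bs) = Fract (Poly_Mapping.single u c * f + g) f"
    using cons.hyps fg \<open>f \<noteq> 0\<close> by (cases bs) (auto simp: b u_def inverse_eq_divide[symmetric])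
  moreover have "cfrac_defined (b # bs)"
    using d nz cons.hyps by (cases bs) auto
  ultimately show ?case using \<open>f \<noteq> 0\<close> by blast
qed

lemma cfrac_defined_S_entries: "cfrac_defined (S_entries n k :: 'k :: field ratfun list)"
proof -
  have "indet_multiple b" if "b \<in> set (folded_word n i)" for b :: "'k ratfun" and i
    using that by (auto simp: folded_word_def word_def word_bar_def
      intro!: indet_multiple_ind_a indet_multiple_uminus split: if_splits)
  then show ?thesis
    by (intro conjunct1[OF cfrac_indet_multiples])
      (auto simp: S_entries_def intro: indet_multiple_ind_a indet_multiple_ind_x)
qed


section \<open>Assembly of the folded identity\<close>

theorem theorem4p1:
  fixes n k :: nat and p q \<epsilon> :: "'k :: field ratfun"
  assumes "n \<ge> 1" and "k \<ge> 2"
  defines "p \<equiv> conv_num ind_a n" and "q \<equiv> conv_den ind_a n" and "\<epsilon> \<equiv> (-1) ^ n"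
  shows "cfrac_defined (S_entries n k :: 'k ratfun list) \<and>
         q \<noteq> 0 \<and>
         mod_continuant \<epsilon> (map (\<lambda>i. ind_x i * q) [1..<k]) \<noteq> 0 \<and>
         S_cfrac n k = p / q +
           (-1) ^ n * mod_continuant \<epsilon> (map (\<lambda>i. ind_x i * q) [2..<k]) /
             (q * mod_continuant \<epsilon> (map (\<lambda>i. ind_x i * q) [1..<k]))"
proof -
  define W where "W = (word n :: 'k ratfun list)"
  define xs where "xs = (map ind_x [1..<k] :: 'k ratfun list)"
  define ts where "ts = folded_tail W (word_bar n) xs"
  define R where "R = cfrac ts"
  define K where "K = (\<lambda>zs. mod_continuant \<epsilon> (map (\<lambda>x. x * q) zs))"
  from \<open>n \<ge> 1\<close> obtain m where n: "n = Suc m"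
    by (cases n) auto
  obtain A B C D where W: "cfrac_matrix W = (A, B, C, D)"
    by (rule prod_cases4)
  define p' where "p' = (conv_num ind_a m :: 'k ratfun)"
  have "map ind_a [0..<Suc (Suc m)] = ind_a 0 # W"
    unfolding W_def word_def n by (simp add: upt_conv_Cons del: upt_Suc)
  then have full: "cfrac_matrix (ind_a 0 # W) = (p, p', q, conv_den ind_a m)"
    using cfrac_matrix_convergents[of "ind_a :: nat \<Rightarrow> 'k ratfun" m]
    by (simp only: n p_def q_def p'_def)
  \<comment> \<open>Prepending \<open>ind_a 0\<close> moves the top row of the matrix of
    \<open>W\<close> to the bottom.\<close>
  have A: "A = q" and B: "conv_den ind_a m = B"
    using full W by auto
  note full = full[unfolded B]
  have len: "length W = n"
    by (simp add: W_def word_def)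
  have tl: "tl xs = map ind_x [2..<k]"
    by (simp add: xs_def map_tl[symmetric] numeral_2_eq_2)
  have ne: "xs \<noteq> []"
    using \<open>k \<ge> 2\<close> by (simp add: xs_def)
  then have "ts \<noteq> []"
    by (cases xs) (auto simp: ts_def)
  have S: "S_entries n k = (ind_a 0 # W) @ ts"
    using folded_tail_eq_concat[of n 1 "k - 1", where 'k = 'k] \<open>k \<ge> 2\<close>
    by (simp add: S_entries_def ts_def W_def xs_def folded_word_def)
  have d: "cfrac_defined ((ind_a 0 # W) @ ts)"
    using cfrac_defined_S_entries[of n k, where 'k = 'k] S by simp
  \<comment> \<open>The unfolded fraction, \<open>k = 1\<close>, has denominator \<open>q\<close>,
    so its definedness yields \<open>q\<close> nonzero.\<close>
  have "S_entries n 1 = ind_a 0 # W"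
    by (simp add: S_entries_def folded_word_def W_def)
  then have "q \<noteq> 0"
    using cfrac_eq_matrix[OF _ full] cfrac_defined_S_entries[of n 1, where 'k = 'k] by simp
  have bar: "cfrac_matrix (word_bar n) = (\<epsilon> * q, - \<epsilon> * C, - \<epsilon> * B, \<epsilon> * D)"
    using cfrac_matrix_bar[OF W refl] len by (simp add: word_bar_def W_def \<epsilon>_def A)
  have det: "q * D - B * C = \<epsilon>"
    using cfrac_matrix_det[OF W] len by (simp add: \<epsilon>_def A)
  have sq: "\<epsilon> * \<epsilon> = 1"
    by (simp add: \<epsilon>_def flip: power_mult_distrib)
  have words: "W \<noteq> []" "word_bar n \<noteq> []"
    using n by (simp_all add: word_bar_def W_def word_def)
  have "cfrac_defined ts"
    using cfrac_defined_appendD[OF d \<open>ts \<noteq> []\<close>] .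
  then have R: "q * R + B = K xs / K (tl xs)"
    using cfrac_folded_tail[OF W[unfolded A] bar det sq words ne]
    unfolding R_def ts_def K_def by blast
  have nz: "q * R + B \<noteq> 0" and val: "S_cfrac n k = (p * R + p') / (q * R + B)"
    using cfrac_append[OF d \<open>ts \<noteq> []\<close> full] by (simp_all add: R_def S_cfrac_def S)
  \<comment> \<open>The list \<open>ind_a 0 # W\<close> has \<open>n + 1\<close> entries, so its
    determinant is \<open>- \<epsilon>\<close>.\<close>
  have "p' * q - p * B = \<epsilon>"
    using cfrac_matrix_det[OF full] len by (simp add: \<epsilon>_def algebra_simps)
  then have "q * (p * R + p') = p * (q * R + B) + \<epsilon>"
    by (auto simp: algebra_simps)
  then have "S_cfrac n k = p / q + \<epsilon> / (q * (q * R + B))"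
    using nz \<open>q \<noteq> 0\<close> unfolding val by (simp add: divide_simps) (simp add: algebra_simps)
  also have "\<epsilon> / (q * (q * R + B)) = \<epsilon> * K (tl xs) / (q * K xs)"
    unfolding R by simp
  finally have "S_cfrac n k = p / q + \<epsilon> * K (tl xs) / (q * K xs)" .
  moreover have "K xs \<noteq> 0"
    using nz R by auto
  moreover have "K xs = mod_continuant \<epsilon> (map (\<lambda>i. ind_x i * q) [1..<k])"
    by (simp add: K_def xs_def comp_def)
  moreover have "K (tl xs) = mod_continuant \<epsilon> (map (\<lambda>i. ind_x i * q) [2..<k])"
    by (simp add: K_def tl comp_def)
  ultimately show ?thesis
    using cfrac_defined_S_entries \<open>q \<noteq> 0\<close> by (simp add: \<epsilon>_def)
qed

end
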